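(* Let $P$ be a polytope with vertices labelled $1,\dots,n$, and identify each face of $P$ with its set of vertices. Given the vertex-facet incidences of $P$, the algorithm FaceIterator visits exactly once all faces of $P$. That is, when called with $C$ the list of facets of $P$ (as vertex sets), empty list $I$ of ignored sets and $J=\emptyset$, it outputs every face of $P$ other than $P$ itself (including the empty face) exactly once and nothing else; the face $P$ is, by convention, visited additionally as the upper bound.
   Context: Algorithm FaceIterator$(C,I,J)$, where $C$ is a list (without repetitions) of subsets of $\{1,\dots,n\}$, $I$ is a list of subsets of $\{1,\dots,n\}$ (ignored sets), and $J\subseteq\{1,\dots,n\}$ (ignored atoms). If $C$ is empty, stop. Otherwise: 1. Let $a$ be the first element of $C$. 2. If $a\cap J=\emptyset$, output $a$. 3. Let $N_1=\{a\cap b : b\in C,\ b\neq a\}$, let $N_2=\{x\in N_1 : x\not\subseteq y \text{ for all } y\in I\}$, and let $N$ be the list (without repetitions) of inclusion-maximal elements of $N_2$. 4. Call FaceIterator$(N, I, J)$ with a copy of $I$ (so that later changes made to $I$ inside this call do not affect the current $I$). 5. Let $C'=\{x\in C : x\not\subseteq a\cup J\}$ and append $a\cup J$ to $I$. 6. Call FaceIterator$(C', I, J)$. *)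

theory Defs
  imports "HOL-Analysis.Analysis" "HOL-Combinatorics.Multiset_Permutations"
begin

definition maximal_intersections :: "'b set \<Rightarrow> 'b set list \<Rightarrow> 'b set list \<Rightarrow> 'b set set" where
  "maximal_intersections a C I =
    (let N1 = {a \<inter> b | b. b \<in> set C \<and> b \<noteq> a};
         N2 = {x \<in> N1. \<forall>y \<in> set I. \<not> x \<subseteq> y}
     in {x \<in> N2. \<forall>y \<in> N2. \<not> x \<subset> y})"

lemma card_maximal_intersections: "card (maximal_intersections a (a # C) I) \<le> length C"
proof -
  have "maximal_intersections a (a # C) I \<subseteq> (\<inter>) a ` set C"
    by (auto simp: maximal_intersections_def Let_def)
  then have "card (maximal_intersections a (a # C) I) \<le> card (set C)"
    by (meson card_image_le card_mono finite_imageI finite_set order_trans)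
  then show ?thesis
    using card_length order_trans by blast
qed

lemma card_not_subset: "card {x \<in> set (a # C). \<not> x \<subseteq> a \<union> J} \<le> length C"
proof -
  have "{x \<in> set (a # C). \<not> x \<subseteq> a \<union> J} \<subseteq> set C"
    by auto
  then have "card {x \<in> set (a # C). \<not> x \<subseteq> a \<union> J} \<le> card (set C)"
    by (rule card_mono[OF finite_set])
  then show ?thesis
    using card_length order_trans by blast
qed

text \<open>The algorithm does not say in which order the repetition-free lists passed to the two
  recursive calls are arranged. Hence \<open>face_iterator C I J\<close> is the set of output lists
  (in order of output) over all possible arrangements. The recursion being well-founded, every
  run terminates.\<close>

function face_iterator :: "'b set list \<Rightarrow> 'b set list \<Rightarrow> 'b set \<Rightarrow> 'b set list set" where
  "face_iterator [] I J = {[]}"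
| "face_iterator (a # C) I J =
    (\<Union>N \<in> permutations_of_set (maximal_intersections a (a # C) I).
     \<Union>C' \<in> permutations_of_set {x \<in> set (a # C). \<not> x \<subseteq> a \<union> J}.
     \<Union>out1 \<in> face_iterator N I J.
     \<Union>out2 \<in> face_iterator C' (I @ [a \<union> J]) J.
       {(if a \<inter> J = {} then [a] else []) @ out1 @ out2})"
  by pat_completeness auto
termination
proof (relation "Wellfounded.measure (\<lambda>(C, I, J). length C)", goal_cases)
  case 1
  show ?case by simp
next
  case (2 a C I J N)
  then show ?case
    using card_maximal_intersections[of a C I] by (simp add: length_finite_permutations_of_set)
next
  case (3 a C I J N C' out1)
  then show ?case
    using card_not_subset[of a C J] length_finite_permutations_of_set[of C']
    by (simp del: set_simps)
qed

text \<open>Unlike \<^const>\<open>facet_of\<close>, this admits the empty face, which is the (only) facet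
  of a single point. In all other cases the two notions agree.\<close>

definition facets :: "'a::euclidean_space set \<Rightarrow> 'a set set" where
  "facets P = {F. F face_of P \<and> aff_dim F = aff_dim P - 1}"

definition vertex_labels :: "nat \<Rightarrow> (nat \<Rightarrow> 'a::euclidean_space) \<Rightarrow> 'a set \<Rightarrow> nat set" where
  "vertex_labels n v F = {i \<in> {1..n}. v i extreme_point_of F}"

end

theory Submission imports Defs begin

text \<open>The faces of a polytope, as vertex sets, form a finite family closed under intersection.
  Every call of the algorithm has \<open>C\<close> equal to the coatoms below some face \<open>u\<close> that are not
  contained in an ignored set, and it outputs the elements strictly below \<open>u\<close> that are not contained
  in an ignored set. The first recursive call, with \<open>u\<close> replaced by \<open>a\<close>, keeps this
  invariant because of a branching property: whenever \<open>x \<subset> a \<subset> u\<close>, some \<open>g\<close> with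
  \<open>x \<subseteq> g \<subset> u\<close> is not contained in \<open>a\<close>. Hence a coatom \<open>x\<close> of \<open>a\<close> is \<open>a \<inter> b\<close> for
  another coatom \<open>b\<close> of \<open>u\<close>.\<close>

section \<open>Coatoms of set families and existence of runs\<close>

definition coatoms :: "'b set set \<Rightarrow> 'b set \<Rightarrow> 'b set set" where
  "coatoms \<F> u = {x \<in> \<F>. x \<subset> u \<and> (\<forall>y\<in>\<F>. y \<subset> u \<longrightarrow> \<not> x \<subset> y)}"

lemma ex_coatom:
  assumes "finite \<F>" "x \<in> \<F>" "x \<subset> u"
  obtains c where "c \<in> coatoms \<F> u" "x \<subseteq> c"
proof -
  have "finite {y \<in> \<F>. y \<subset> u}" "x \<in> {y \<in> \<F>. y \<subset> u}"
    using assms by simp_all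
  from finite_has_maximal2[OF this] obtain c
    where c: "c \<in> {y \<in> \<F>. y \<subset> u}" "x \<subseteq> c"
      and max: "\<forall>y \<in> {y \<in> \<F>. y \<subset> u}. c \<subseteq> y \<longrightarrow> c = y"
    by blast
  then have "c \<in> coatoms \<F> u"
    by (auto simp: coatoms_def)
  with c that show thesis by blast
qed

text \<open>The case of interest has faces as members of \<open>\<F>\<close> and vertex labelling as
  \<open>f\<close>: facets then become coatoms of the family of label sets.\<close>

lemma coatoms_image:
  assumes "\<And>x y. x \<in> \<F> \<Longrightarrow> y \<in> \<F> \<Longrightarrow> f x \<subset> f y \<longleftrightarrow> x \<subset> y" "u \<in> \<F>"
  shows "coatoms (f ` \<F>) (f u) = f ` coatoms \<F> u"
proof -
  have "{x \<in> \<F>. f x \<subset> f u \<and> (\<forall>y\<in>\<F>. f y \<subset> f u \<longrightarrow> \<not> f x \<subset> f y)}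
      = {x \<in> \<F>. x \<subset> u \<and> (\<forall>y\<in>\<F>. y \<subset> u \<longrightarrow> \<not> x \<subset> y)}"
    using assms by (intro Collect_cong conj_cong ball_cong refl) simp_all
  then show ?thesis
    by (simp add: coatoms_def Compr_image_eq)
qed

text \<open>A claim about all outputs would be vacuous without this. The sets to be arranged are
  finite, so each has an arrangement.\<close>

lemma face_iterator_nonempty: "face_iterator C I J \<noteq> {}"
proof (induction C I J rule: face_iterator.induct)
  case (1 I J)
  show ?case by simp
next
  case (2 a C I J)
  \<comment> \<open>Finiteness matters: \<open>permutations_of_set\<close> of an infinite set is
    empty.\<close>
  have "maximal_intersections a (a # C) I \<subseteq> (\<inter>) a ` set C"
    by (auto simp: maximal_intersections_def Let_def)
  then have "finite (maximal_intersections a (a # C) I)"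
    by (rule finite_subset) simp
  then have "permutations_of_set (maximal_intersections a (a # C) I) \<noteq> {}"
    by simp
  then obtain N where N: "N \<in> permutations_of_set (maximal_intersections a (a # C) I)"
    by blast
  have "permutations_of_set {x \<in> set (a # C). \<not> x \<subseteq> a \<union> J} \<noteq> {}"
    by (simp del: set_simps)
  then obtain C' where C': "C' \<in> permutations_of_set {x \<in> set (a # C). \<not> x \<subseteq> a \<union> J}"
    by blast
  obtain out1 where out1: "out1 \<in> face_iterator N I J"
    using "2.IH"(1)[OF N C'] by blast
  obtain out2 where "out2 \<in> face_iterator C' (I @ [a \<union> J]) J"
    using "2.IH"(2)[OF N C' out1] by blast
  with N C' out1 show ?case
    unfolding face_iterator.simps by blast
qed

section \<open>Correctness for abstract branching families\<close>

locale branching_family =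
  fixes \<F> :: "'b set set"
  assumes finite: "finite \<F>"
    and Int_closed: "x \<in> \<F> \<Longrightarrow> y \<in> \<F> \<Longrightarrow> x \<inter> y \<in> \<F>"
    and branching: "x \<in> \<F> \<Longrightarrow> a \<in> \<F> \<Longrightarrow> u \<in> \<F> \<Longrightarrow> x \<subset> a \<Longrightarrow> a \<subset> u \<Longrightarrow>
      \<exists>g\<in>\<F>. x \<subseteq> g \<and> g \<subset> u \<and> \<not> g \<subseteq> a"
begin

text \<open>Branching acts as a weak diamond property. Its witness \<open>g\<close> extends to a
  coatom \<open>b\<close> of \<open>u\<close> other than \<open>a\<close>. Distinct coatoms are
  incomparable, so \<open>a \<inter> b\<close> is strictly below \<open>a\<close> while containing
  \<open>x\<close>, and maximality of \<open>x\<close> forces equality.\<close>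

lemma coatom_Int_coatom:
  assumes "u \<in> \<F>" "a \<in> coatoms \<F> u" "x \<in> coatoms \<F> a"
  obtains b where "b \<in> coatoms \<F> u" "b \<noteq> a" "a \<inter> b = x"
proof -
  have mem: "a \<in> \<F>" "x \<in> \<F>" "x \<subset> a" "a \<subset> u"
    using assms by (auto simp: coatoms_def)
  then obtain g where g: "g \<in> \<F>" "x \<subseteq> g" "g \<subset> u" "\<not> g \<subseteq> a"
    using branching[OF mem(2,1) assms(1) mem(3,4)] by blast
  obtain b where b: "b \<in> coatoms \<F> u" "g \<subseteq> b"
    using ex_coatom[OF finite g(1,3)] by blast
  have "b \<in> \<F>" "\<not> a \<subset> b"
    using assms(2) b(1) by (auto simp: coatoms_def)
  moreover have "b \<noteq> a" using b g by blast
  ultimately have "a \<inter> b \<in> \<F>" "a \<inter> b \<subset> a" "x \<subseteq> a \<inter> b"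
    using Int_closed[OF mem(1), of b] mem(3) b(2) g(2) by blast+
  then have "a \<inter> b = x"
    using assms(3) by (auto simp: coatoms_def)
  with b \<open>b \<noteq> a\<close> that show thesis by blast
qed

text \<open>This carries the invariant from \<open>u\<close> to \<open>a\<close>. Not being ignored
  is inherited by supersets, so discarding ignored sets before taking maxima loses no coatom of
  \<open>a\<close> that should remain.\<close>

lemma maximal_intersections_eq:
  assumes u: "u \<in> \<F>" and C: "set C = {c \<in> coatoms \<F> u. \<forall>y\<in>set I. \<not> c \<subseteq> y}"
    and a: "a \<in> set C"
  shows "maximal_intersections a C I = {c \<in> coatoms \<F> a. \<forall>y\<in>set I. \<not> c \<subseteq> y}"
proof -
  define N2 where "N2 = {x \<in> {a \<inter> b | b. b \<in> set C \<and> b \<noteq> a}. \<forall>y\<in>set I. \<not> x \<subseteq> y}"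
  have ac: "a \<in> coatoms \<F> u" using a C by simp
  have below: "x \<in> \<F> \<and> x \<subset> a" if x: "x \<in> N2" for x
  proof -
    obtain b where b: "x = a \<inter> b" "b \<in> coatoms \<F> u" "b \<noteq> a"
      using x by (auto simp: N2_def C)
    then have "a \<in> \<F>" "b \<in> \<F>" "\<not> a \<subset> b"
      using ac by (auto simp: coatoms_def)
    then show ?thesis using b Int_closed[of a b] by blast
  qed
  have mem_N2: "x \<in> N2" if x: "x \<in> coatoms \<F> a" "\<forall>y\<in>set I. \<not> x \<subseteq> y" for x
  proof -
    obtain b where b: "b \<in> coatoms \<F> u" "b \<noteq> a" "a \<inter> b = x"
      using coatom_Int_coatom[OF u ac x(1)] .
    \<comment> \<open>An ignored set containing \<open>b\<close> would contain \<open>x\<close> as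
      well, so \<open>b\<close> is still in \<open>C\<close>.\<close>
    then have "x \<subseteq> b" by blast
    then have "\<forall>y\<in>set I. \<not> b \<subseteq> y"
      using x(2) subset_trans[of x b] by blast
    with b(1) have "b \<in> set C" by (simp add: C)
    with b x(2) show ?thesis
      unfolding N2_def by (intro CollectI conjI exI[of _ b]) simp_all
  qed
  have "maximal_intersections a C I = {x \<in> N2. \<forall>y\<in>N2. \<not> x \<subset> y}"
    unfolding maximal_intersections_def N2_def Let_def by (rule refl)
  also have "\<dots> = {c \<in> coatoms \<F> a. \<forall>y\<in>set I. \<not> c \<subseteq> y}"
  proof (intro subset_antisym subsetI)
    fix x assume "x \<in> {x \<in> N2. \<forall>y\<in>N2. \<not> x \<subset> y}"
    then have x: "x \<in> N2" "\<forall>y\<in>N2. \<not> x \<subset> y" by auto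
    then have nI: "\<forall>y\<in>set I. \<not> x \<subseteq> y" by (simp add: N2_def)
    obtain c where c: "c \<in> coatoms \<F> a" "x \<subseteq> c"
      using ex_coatom[OF finite, of x a] below[OF x(1)] by blast
    have "\<forall>y\<in>set I. \<not> c \<subseteq> y"
      using c(2) nI by blast
    with c(1) have "c \<in> N2" by (rule mem_N2)
    then have "x = c" using x(2) c(2) by blast
    with c nI show "x \<in> {c \<in> coatoms \<F> a. \<forall>y\<in>set I. \<not> c \<subseteq> y}" by simp
  next
    fix x assume x: "x \<in> {c \<in> coatoms \<F> a. \<forall>y\<in>set I. \<not> c \<subseteq> y}"
    then have "x \<in> N2" using mem_N2 by blast
    moreover have "\<not> x \<subset> y" if "y \<in> N2" for y
      using below[OF that] x by (auto simp: coatoms_def)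
    ultimately show "x \<in> {x \<in> N2. \<forall>y\<in>N2. \<not> x \<subset> y}" by blast
  qed
  finally show ?thesis .
qed

text \<open>Relative to the head \<open>a\<close>, a set to be output equals \<open>a\<close>, lies
  strictly below it, or is not contained in it. These disjoint cases are served by the output step,
  the first call and the second call respectively.\<close>

lemma face_iterator_correct:
  assumes "u \<in> \<F>" "set C = {c \<in> coatoms \<F> u. \<forall>y\<in>set I. \<not> c \<subseteq> y}"
    and "out \<in> face_iterator C I {}"
  shows "distinct out \<and> set out = {x \<in> \<F>. x \<subset> u \<and> (\<forall>y\<in>set I. \<not> x \<subseteq> y)}"
  using assms
proof (induction C I "{} :: 'b set" arbitrary: u out rule: face_iterator.induct)
  case (1 I)
  \<comment> \<open>A set that is not ignored lies below a coatom that is not ignored either, but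
    \<open>C\<close> is empty.\<close>
  have none: "\<not> (x \<in> \<F> \<and> x \<subset> u \<and> (\<forall>y\<in>set I. \<not> x \<subseteq> y))" for x
  proof
    assume x: "x \<in> \<F> \<and> x \<subset> u \<and> (\<forall>y\<in>set I. \<not> x \<subseteq> y)"
    then obtain c where "c \<in> coatoms \<F> u" "x \<subseteq> c"
      using ex_coatom[OF finite, of x u] by metis
    with x have "c \<in> {c \<in> coatoms \<F> u. \<forall>y\<in>set I. \<not> c \<subseteq> y}" by blast
    then show False unfolding "1.prems"(2)[symmetric] by simp
  qed
  have "{x \<in> \<F>. x \<subset> u \<and> (\<forall>y\<in>set I. \<not> x \<subseteq> y)} = {}"
    unfolding Collect_empty_eq by (intro allI none)
  with "1.prems"(3) show ?case by simp
next
  case (2 a C I)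
  note u = "2.prems"(1) and C = "2.prems"(2)
  obtain N C' out1 out2
    where N: "N \<in> permutations_of_set (maximal_intersections a (a # C) I)"
      and C': "C' \<in> permutations_of_set {x \<in> set (a # C). \<not> x \<subseteq> a \<union> {}}"
      and out1: "out1 \<in> face_iterator N I {}"
      and out2: "out2 \<in> face_iterator C' (I @ [a \<union> {}]) {}"
      and out: "out = a # out1 @ out2"
    using "2.prems"(3) unfolding face_iterator.simps by auto
  have a: "a \<in> coatoms \<F> u" "\<forall>y\<in>set I. \<not> a \<subseteq> y"
    using C list.set_intros(1)[of a C] by blast+
  then have aF: "a \<in> \<F>" "a \<subset> u" by (auto simp: coatoms_def)
  have "set N = {c \<in> coatoms \<F> a. \<forall>y\<in>set I. \<not> c \<subseteq> y}"
    using N maximal_intersections_eq[OF u C] by (simp add: permutations_of_set_def)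
  from "2.hyps"(1)[OF N C' aF(1) this out1]
  have out1_set: "distinct out1" "set out1 = {x \<in> \<F>. x \<subset> a \<and> (\<forall>y\<in>set I. \<not> x \<subseteq> y)}"
    by simp_all
  have "set C' = {x \<in> set (a # C). \<not> x \<subseteq> a}"
    using C' by (simp add: permutations_of_set_def)
  \<comment> \<open>The second call keeps \<open>u\<close>: removing the subsets of \<open>a\<close>
    from \<open>C\<close> matches adding \<open>a\<close> to the ignored sets.\<close>
  then have "set C' = {c \<in> coatoms \<F> u. \<forall>y\<in>set (I @ [a \<union> {}]). \<not> c \<subseteq> y}"
    unfolding C by (simp add: conj_ac)
  from "2.hyps"(2)[OF N C' out1 u this out2]
  have out2_set: "distinct out2"
      "set out2 = {x \<in> \<F>. x \<subset> u \<and> (\<forall>y\<in>set I. \<not> x \<subseteq> y) \<and> \<not> x \<subseteq> a}"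
    by (simp_all add: conj_ac)
  have "set out1 \<inter> set out2 = {}"
    by (simp add: out1_set out2_set disjoint_iff psubset_eq)
  moreover have "a \<notin> set out1" "a \<notin> set out2"
    by (simp_all add: out1_set out2_set)
  ultimately have "distinct out"
    using out1_set(1) out2_set(1) by (simp add: out)
  moreover have "x \<in> set out \<longleftrightarrow> x \<in> \<F> \<and> x \<subset> u \<and> (\<forall>y\<in>set I. \<not> x \<subseteq> y)" for x
  proof -
    consider "x = a" | "x \<subset> a" | "\<not> x \<subseteq> a" by blast
    then show ?thesis
    proof cases
      case 1
      then show ?thesis using a(2) aF by (simp add: out)
    next
      case 2
      then have "x \<subset> u" "x \<noteq> a" "x \<subseteq> a" using aF(2) by auto
      with 2 show ?thesis by (simp add: out out1_set out2_set)
    next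
      case 3
      then have "x \<noteq> a" "\<not> x \<subset> a" by auto
      with 3 show ?thesis by (simp add: out out1_set out2_set)
    qed
  qed
  ultimately show ?case by (simp add: set_eq_iff)
qed

end

section \<open>Faces and facets of polytopes\<close>

lemma polytope_face_eq_hull:
  fixes P :: "'a::euclidean_space set"
  assumes "polytope P" "F face_of P"
  shows "F = convex hull {x. x extreme_point_of F}"
proof -
  have "polytope F"
    using assms face_of_polytope_polytope by blast
  then show ?thesis
    using Krein_Milman_Minkowski[of F] polytope_imp_compact polytope_imp_convex by blast
qed

text \<open>A nonempty \<open>X\<close> is the intersection of the facets of \<open>U\<close>
  containing it, so one of them fails to contain \<open>A\<close>; this facet serves as
  \<open>G\<close>. For empty \<open>X\<close>, a vertex of \<open>U\<close> outside
  \<open>A\<close> does.\<close>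

lemma polytope_face_branching:
  fixes P :: "'a::euclidean_space set"
  assumes P: "polytope P" and faces: "X face_of P" "A face_of P" "U face_of P"
    and sub: "X \<subset> A" "A \<subset> U"
  shows "\<exists>G. G face_of P \<and> X \<subseteq> G \<and> G \<subset> U \<and> \<not> G \<subseteq> A"
proof -
  have U: "polytope U" using P faces face_of_polytope_polytope by blast
  have XU: "X face_of U" "A face_of U"
    using face_of_subset[of _ P U] face_of_imp_subset[OF faces(3)] faces sub by auto
  have "\<exists>G. G face_of U \<and> X \<subseteq> G \<and> G \<noteq> U \<and> \<not> G \<subseteq> A"
  proof (cases "X = {}")
    case True
    have "\<exists>q. q extreme_point_of U \<and> q \<notin> A"
    proof (rule ccontr)
      assume "\<not> ?thesis"
      then have "convex hull {x. x extreme_point_of U} \<subseteq> A"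
        using XU(2) face_of_imp_convex by (intro hull_minimal) auto
      with polytope_face_eq_hull[OF P faces(3)] sub show False by auto
    qed
    then obtain q where q: "q extreme_point_of U" "q \<notin> A" by blast
    \<comment> \<open>\<open>A\<close> is a nonempty proper subset of \<open>U\<close>, so
      \<open>U\<close> is not a single point.\<close>
    have "{q} \<noteq> U" using q sub True by auto
    then show ?thesis
      using q True by (intro exI[of _ "{q}"]) (simp add: face_of_singleton)
  next
    case False
    have eq: "X = \<Inter>{h. h facet_of U \<and> X \<subseteq> h}"
      using face_of_polyhedron[OF polytope_imp_polyhedron[OF U] XU(1) False] sub by blast
    then obtain h where h: "h facet_of U" "X \<subseteq> h" "\<not> A \<subseteq> h"
      using sub(1) Inter_greatest[of "{h. h facet_of U \<and> X \<subseteq> h}" A, folded eq] by blast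
    \<comment> \<open>Otherwise \<open>h\<close> is a proper face of \<open>A\<close> and
      \<open>A\<close> one of \<open>U\<close>, so the dimension drops by at least two from
      \<open>U\<close> to \<open>h\<close>, too much for a facet.\<close>
    have "\<not> h \<subseteq> A"
    proof
      assume "h \<subseteq> A"
      then have "h face_of A"
        using face_of_subset[OF facet_of_imp_face_of[OF h(1)]] face_of_imp_subset[OF XU(2)] by blast
      moreover have "h \<noteq> A" using h(3) by blast
      ultimately have "aff_dim h < aff_dim A"
        using face_of_aff_dim_lt[OF face_of_imp_convex[OF XU(2)]] by blast
      moreover have "aff_dim A < aff_dim U"
        using face_of_aff_dim_lt[OF polytope_imp_convex[OF U] XU(2)] sub by blast
      ultimately show False using h(1) by (simp add: facet_of_def)
    qed
    then show ?thesis
      using h facet_of_imp_face_of[OF h(1)] facet_of_irrefl by blast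
  qed
  then obtain G where G: "G face_of U" "X \<subseteq> G" "G \<noteq> U" "\<not> G \<subseteq> A" by blast
  then have "G face_of P" "G \<subset> U"
    using face_of_trans[OF G(1) faces(3)] face_of_imp_subset[OF G(1)] by auto
  with G show ?thesis by blast
qed

text \<open>A strictly larger face has larger dimension, so no face fits strictly between one of
  codimension one and \<open>P\<close>. Conversely, a nonempty proper face lies in a facet, and
  maximality makes the two equal.\<close>

lemma facets_eq_coatoms:
  fixes P :: "'a::euclidean_space set"
  assumes P: "polytope P"
  shows "facets P = coatoms {F. F face_of P} P"
proof (intro subset_antisym subsetI)
  note conv = polytope_imp_convex[OF P]
  fix F assume "F \<in> facets P"
  then have F: "F face_of P" "aff_dim F = aff_dim P - 1" by (auto simp: facets_def)
  have "\<not> F \<subset> G" if G: "G face_of P" "G \<subset> P" for G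
  proof
    assume "F \<subset> G"
    then have "F face_of G" "F \<noteq> G"
      using face_of_subset[OF F(1), of G] face_of_imp_subset[OF G(1)] by auto
    then have "aff_dim F < aff_dim G"
      using face_of_aff_dim_lt[OF face_of_imp_convex[OF G(1)]] by blast
    moreover have "aff_dim G < aff_dim P"
      using face_of_aff_dim_lt[OF conv G(1)] G(2) by blast
    ultimately show False using F(2) by simp
  qed
  moreover have "F \<subset> P" using F face_of_imp_subset[OF F(1)] by auto
  ultimately show "F \<in> coatoms {F. F face_of P} P"
    using F(1) by (auto simp: coatoms_def)
next
  fix F assume "F \<in> coatoms {F. F face_of P} P"
  then have F: "F face_of P" "F \<subset> P" and max: "\<And>G. G face_of P \<Longrightarrow> G \<subset> P \<Longrightarrow> \<not> F \<subset> G"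
    by (auto simp: coatoms_def)
  show "F \<in> facets P"
  proof (cases "F = {}")
    \<comment> \<open>Any vertex gives a face strictly above the empty one, so \<open>P\<close> is
      that single point; the dimensions are -1 and 0.\<close>
    case True
    have "P = convex hull {x. x extreme_point_of P}"
      using polytope_face_eq_hull[OF P face_of_refl[OF polytope_imp_convex[OF P]]] .
    then have "{x. x extreme_point_of P} \<noteq> {}"
      using F(2) True by auto
    then obtain q where "{q} face_of P" by (auto simp: face_of_singleton)
    with max[of "{q}"] True have "P = {q}"
      using face_of_imp_subset[of "{q}" P] by blast
    with F(1) True show ?thesis by (simp add: facets_def)
  next
    case False
    have "F = \<Inter>{h. h facet_of P \<and> F \<subseteq> h}"
      using face_of_polyhedron[OF polytope_imp_polyhedron[OF P] F(1) False] F(2) by blast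
    \<comment> \<open>If no facet contained \<open>F\<close>, the intersection would be the whole
      space, contrary to \<open>F \<subset> P\<close>.\<close>
    then obtain h where h: "h facet_of P" "F \<subseteq> h"
      using F(2) face_of_imp_subset[OF F(1)] by blast
    then have "h \<subset> P"
      using facet_of_imp_subset[of h P] facet_of_irrefl by blast
    with max[of h] h have "F = h"
      using facet_of_imp_face_of[OF h(1)] by blast
    with h show ?thesis by (simp add: facets_def facet_of_def)
  qed
qed

section \<open>Vertex labels of faces\<close>

lemma vertex_labels_face:
  assumes "F face_of P"
  shows "vertex_labels n v F = {i \<in> {1..n}. v i extreme_point_of P \<and> v i \<in> F}"
  using extreme_point_of_face[OF assms] by (auto simp: vertex_labels_def)

lemma vertex_labels_Int:
  assumes "F face_of P" "G face_of P"
  shows "vertex_labels n v (F \<inter> G) = vertex_labels n v F \<inter> vertex_labels n v G"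
  unfolding vertex_labels_face[OF assms(1)] vertex_labels_face[OF assms(2)]
    vertex_labels_face[OF face_of_Int[OF assms]] by auto

text \<open>Each vertex of \<open>F\<close> is a vertex of \<open>P\<close> and so has a label.
  Inclusion of labels thus passes to extreme points and, by taking convex hulls, to the
  faces.\<close>

lemma vertex_labels_subset_iff:
  fixes P :: "'a::euclidean_space set"
  assumes P: "polytope P" and v: "v ` {1..n} = {x. x extreme_point_of P}"
    and F: "F face_of P" and G: "G face_of P"
  shows "vertex_labels n v F \<subseteq> vertex_labels n v G \<longleftrightarrow> F \<subseteq> G"
proof
  assume sub: "vertex_labels n v F \<subseteq> vertex_labels n v G"
  have "{x. x extreme_point_of F} \<subseteq> {x. x extreme_point_of G}"
  proof clarify
    fix x assume x: "x extreme_point_of F"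
    then obtain i where "i \<in> {1..n}" "x = v i"
      using v extreme_point_of_face[OF F] by blast
    with x sub show "x extreme_point_of G" by (auto simp: vertex_labels_def)
  qed
  then show "F \<subseteq> G"
    using hull_mono[of _ _ convex] polytope_face_eq_hull[OF P F] polytope_face_eq_hull[OF P G]
    by metis
qed (auto simp: vertex_labels_face[OF F] vertex_labels_face[OF G])

theorem corollary3p8:
  fixes P :: "'a::euclidean_space set" and v :: "nat \<Rightarrow> 'a" and n :: nat
    and C :: "nat set list"
  assumes "polytope P"
    and "bij_betw v {1..n} {x. x extreme_point_of P}"
    and "distinct C" and "set C = vertex_labels n v ` facets P"
  shows "face_iterator C [] {} \<noteq> {} \<and>
    (\<forall>out \<in> face_iterator C [] {}.
       distinct out \<and>
       bij_betw (vertex_labels n v) {F. F face_of P \<and> F \<noteq> P} (set out) \<and>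
       distinct (vertex_labels n v P # out) \<and>
       bij_betw (vertex_labels n v) {F. F face_of P} (set (vertex_labels n v P # out)))"
proof -
  let ?\<phi> = "vertex_labels n v"
  let ?\<F> = "{F. F face_of P}"
  note le = vertex_labels_subset_iff[OF assms(1) bij_betw_imp_surj_on[OF assms(2)]]
  \<comment> \<open>Labelling is an order embedding of the faces, so the family of label sets
    inherits the order properties of the face lattice.\<close>
  have less: "?\<phi> F \<subset> ?\<phi> G \<longleftrightarrow> F \<subset> G" if "F face_of P" "G face_of P" for F G
    using le that by (simp add: less_le_not_le)
  have inj: "inj_on ?\<phi> ?\<F>"
    using le by (intro inj_onI) (metis mem_Collect_eq order_refl subset_antisym)
  have PF: "P face_of P"
    using assms(1) face_of_refl polytope_imp_convex by blast
  interpret branching_family "?\<phi> ` ?\<F>"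
  proof
    show "finite (?\<phi> ` ?\<F>)"
      using finite_polytope_faces[OF assms(1)] by simp
    show "x \<inter> y \<in> ?\<phi> ` ?\<F>" if xy: "x \<in> ?\<phi> ` ?\<F>" "y \<in> ?\<phi> ` ?\<F>" for x y
    proof -
      obtain F G where "F face_of P" "G face_of P" "x = ?\<phi> F" "y = ?\<phi> G"
        using xy by blast
      then show ?thesis
        using vertex_labels_Int[of F P G n v] face_of_Int by blast
    qed
    show "\<exists>g\<in>?\<phi> ` ?\<F>. x \<subseteq> g \<and> g \<subset> u \<and> \<not> g \<subseteq> a"
      if mem: "x \<in> ?\<phi> ` ?\<F>" "a \<in> ?\<phi> ` ?\<F>" "u \<in> ?\<phi> ` ?\<F>" and sub: "x \<subset> a" "a \<subset> u" for x a u
    proof -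
      obtain X A U where XAU: "X face_of P" "A face_of P" "U face_of P"
          and eq: "x = ?\<phi> X" "a = ?\<phi> A" "u = ?\<phi> U"
        using mem by blast
      have "X \<subset> A" "A \<subset> U"
        using sub less XAU unfolding eq by simp_all
      then obtain G where G: "G face_of P" "X \<subseteq> G" "G \<subset> U" "\<not> G \<subseteq> A"
        using polytope_face_branching[OF assms(1) XAU] by metis
      then show ?thesis
        unfolding eq using XAU le less by (intro bexI[of _ "?\<phi> G"] conjI) simp_all
    qed
  qed
  \<comment> \<open>The initial call satisfies the invariant with \<open>u\<close> the label set of
    \<open>P\<close> and nothing ignored.\<close>
  have C: "set C = {c \<in> coatoms (?\<phi> ` ?\<F>) (?\<phi> P). \<forall>y\<in>set []. \<not> c \<subseteq> y}"
    using coatoms_image[of ?\<F> ?\<phi> P] PF less by (simp add: assms(4) facets_eq_coatoms[OF assms(1)])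
  have out: "distinct out \<and> set out = ?\<phi> ` {F. F face_of P \<and> F \<noteq> P}"
    if "out \<in> face_iterator C [] {}" for out
  proof -
    have "distinct out \<and> set out = {x \<in> ?\<phi> ` ?\<F>. x \<subset> ?\<phi> P}"
      using face_iterator_correct[OF _ C that] PF by simp
    moreover have "{F \<in> ?\<F>. ?\<phi> F \<subset> ?\<phi> P} = {F. F face_of P \<and> F \<noteq> P}"
      using less[OF _ PF] face_of_imp_subset[of _ P]
      by (intro Collect_cong) (metis mem_Collect_eq psubset_eq)
    then have "{x \<in> ?\<phi> ` ?\<F>. x \<subset> ?\<phi> P} = ?\<phi> ` {F. F face_of P \<and> F \<noteq> P}"
      by (simp only: Compr_image_eq)
    ultimately show ?thesis by simp
  qed
  have "?\<F> = insert P {F. F face_of P \<and> F \<noteq> P}"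
    using PF by blast
  then have image: "?\<phi> ` ?\<F> = insert (?\<phi> P) (?\<phi> ` {F. F face_of P \<and> F \<noteq> P})"
    by (metis (no_types) image_insert)
  \<comment> \<open>By injectivity no proper face has the labels of \<open>P\<close>, so prepending
    \<open>P\<close> as the upper bound creates no repetition.\<close>
  have notin: "?\<phi> P \<notin> ?\<phi> ` {F. F face_of P \<and> F \<noteq> P}"
    using inj PF by (auto dest: inj_onD)
  have "bij_betw ?\<phi> {F. F face_of P \<and> F \<noteq> P} (?\<phi> ` {F. F face_of P \<and> F \<noteq> P})"
    by (rule inj_on_imp_bij_betw[OF inj_on_subset[OF inj]]) blast
  moreover have "bij_betw ?\<phi> ?\<F> (insert (?\<phi> P) (?\<phi> ` {F. F face_of P \<and> F \<noteq> P}))"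
    using inj_on_imp_bij_betw[OF inj] by (simp only: image)
  ultimately show ?thesis
    using face_iterator_nonempty[of C "[]" "{}"] out notin by simp
qed

end
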